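(* Let $R$ be a ring and let $\theta : Q_l(R)\to Q_l^s(R)$, $s^{-1}r\mapsto s^{-1}r$ ($s\in S_{l,0}(R)$, $r\in R$), be the canonical ring homomorphism. The following statements are equivalent. 1. $S_{l,0}(R)=T_l(R)$. 2. $\mathfrak{l}^s_R=0$. 3. $\theta$ is an isomorphism. 4. $\theta$ is a monomorphism. 5. $\theta$ is an epimorphism and $S_{l,0}(R)+\mathfrak{l}^s_R\subseteq S_{l,0}(R)$.
   Context: Rings are associative with $1$ and nonzero. A multiplicative subset $S$ of $R$ is a submonoid of $(R,\cdot)$ with $1\in S$, $0\notin S$. It is a left Ore set if $Sr\cap Rs\neq\emptyset$ for all $r\in R$, $s\in S$; then $\mathrm{ass}(S):=\{r\in R\mid sr=0 \text{ for some } s\in S\}$ is an ideal. A left Ore set $S$ is a left denominator set if $rs=0$ with $r\in R$, $s\in S$ implies $r\in\mathrm{ass}(S)$. $\mathrm{Den}_l(R)$ is the set of left denominator sets of $R$; for $S\in\mathrm{Den}_l(R)$, $S^{-1}R=\{s^{-1}r\mid s\in S,r\in R\}$ is the left localization. $\mathrm{max.Den}_l(R)$ is the (non-empty) set of elements of $\mathrm{Den}_l(R)$ maximal under inclusion. $\mathcal{L}^s_l(R):=\bigcap_{S\in \mathrm{max.Den}_l(R)}S$. $T_l(R)$ is the union of all $S\in\mathrm{Den}_l(R)$ with $S\subseteq\mathcal{L}^s_l(R)$; it is the largest left denominator set of $R$ contained in $\mathcal{L}^s_l(R)$. $Q_l^s(R):=T_l(R)^{-1}R$ and $\mathfrak{l}^s_R:=\mathrm{ass}(T_l(R))$.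 $S_{l,0}(R)$ is the largest (under inclusion) left denominator set $S$ of $R$ with $\mathrm{ass}(S)=0$ (it exists), and $Q_l(R):=S_{l,0}(R)^{-1}R$. One has $S_{l,0}(R)\subseteq T_l(R)$, so that $\theta$ is well defined. Here "monomorphism" means injective and "epimorphism" means surjective ring homomorphism. *)

theory Defs
  imports "HOL-Algebra.QuotRing"
begin

section \<open>Left denominator sets\<close>

definition multiplicative_subset :: "('a, 'm) ring_scheme \<Rightarrow> 'a set \<Rightarrow> bool"
  where "multiplicative_subset R S \<longleftrightarrow> submonoid S R \<and> \<zero>\<^bsub>R\<^esub> \<notin> S"

definition left_Ore_set :: "('a, 'm) ring_scheme \<Rightarrow> 'a set \<Rightarrow> bool"
  where "left_Ore_set R S \<longleftrightarrow> multiplicative_subset R S \<and>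
    (\<forall>r\<in>carrier R. \<forall>s\<in>S. (S #>\<^bsub>R\<^esub> r) \<inter> (carrier R #>\<^bsub>R\<^esub> s) \<noteq> {})"

definition ass :: "('a, 'm) ring_scheme \<Rightarrow> 'a set \<Rightarrow> 'a set"
  where "ass R S = {r \<in> carrier R. \<exists>s\<in>S. s \<otimes>\<^bsub>R\<^esub> r = \<zero>\<^bsub>R\<^esub>}"

definition Den_l :: "('a, 'm) ring_scheme \<Rightarrow> 'a set set"
  where "Den_l R = {S. left_Ore_set R S \<and>
    (\<forall>r\<in>carrier R. \<forall>s\<in>S. r \<otimes>\<^bsub>R\<^esub> s = \<zero>\<^bsub>R\<^esub> \<longrightarrow> r \<in> ass R S)}"

definition max_Den_l :: "('a, 'm) ring_scheme \<Rightarrow> 'a set set"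
  where "max_Den_l R = {S \<in> Den_l R. \<forall>S'\<in>Den_l R. S \<subseteq> S' \<longrightarrow> S' = S}"

definition L_s_l :: "('a, 'm) ring_scheme \<Rightarrow> 'a set"
  where "L_s_l R = \<Inter> (max_Den_l R)"

definition T_l :: "('a, 'm) ring_scheme \<Rightarrow> 'a set"
  where "T_l R = \<Union> {S \<in> Den_l R. S \<subseteq> L_s_l R}"

definition l_s :: "('a, 'm) ring_scheme \<Rightarrow> 'a set"
  where "l_s R = ass R (T_l R)"

text \<open>On sets, \<open>GREATEST\<close> refers to the inclusion order.\<close>

definition S_l0 :: "('a, 'm) ring_scheme \<Rightarrow> 'a set"
  where "S_l0 R = (GREATEST S. S \<in> Den_l R \<and> ass R S = {\<zero>\<^bsub>R\<^esub>})"


section \<open>Left localization\<close>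

text \<open>
  The elements of \<open>S\<^sup>-\<^sup>1R\<close> are classes of pairs, \<open>(s, a)\<close> standing for \<open>s\<^sup>-\<^sup>1a\<close>. Two pairs are
  identified if they can be brought to a common denominator \<open>c s = d t \<in> S\<close> with equal
  numerators \<open>c a = d b\<close>; the multipliers \<open>c, d\<close> range over \<open>R\<close> and need not lie in \<open>S\<close>.
\<close>

definition frac_rel :: "('a, 'm) ring_scheme \<Rightarrow> 'a set \<Rightarrow> (('a \<times> 'a) \<times> ('a \<times> 'a)) set"
  where "frac_rel R S = {((s, a), (t, b)). s \<in> S \<and> a \<in> carrier R \<and> t \<in> S \<and> b \<in> carrier R \<and>
    (\<exists>c\<in>carrier R. \<exists>d\<in>carrier R. c \<otimes>\<^bsub>R\<^esub> s \<in> S \<and>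
      c \<otimes>\<^bsub>R\<^esub> s = d \<otimes>\<^bsub>R\<^esub> t \<and> c \<otimes>\<^bsub>R\<^esub> a = d \<otimes>\<^bsub>R\<^esub> b)}"

definition left_frac :: "('a, 'm) ring_scheme \<Rightarrow> 'a set \<Rightarrow> 'a \<Rightarrow> 'a \<Rightarrow> ('a \<times> 'a) set"
  where "left_frac R S s a = frac_rel R S `` {(s, a)}"

text \<open>
  The product rests on \<open>a t\<^sup>-\<^sup>1 = u\<^sup>-\<^sup>1c\<close> whenever \<open>u a = c t\<close> with \<open>u \<in> S\<close>, and
  the sum on bringing both fractions to a common denominator \<open>c s = d t \<in> S\<close>.
  For a left denominator set \<open>S\<close> such multipliers exist and the resulting
  fraction does not depend on the choice of representatives and multipliers, so that each union
  below is a union of copies of a single class.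
\<close>

definition frac_mult ::
  "('a, 'm) ring_scheme \<Rightarrow> 'a set \<Rightarrow> ('a \<times> 'a) set \<Rightarrow> ('a \<times> 'a) set \<Rightarrow> ('a \<times> 'a) set"
  where "frac_mult R S A B = \<Union> {left_frac R S (u \<otimes>\<^bsub>R\<^esub> s) (c \<otimes>\<^bsub>R\<^esub> b) | s a t b u c.
    (s, a) \<in> A \<and> (t, b) \<in> B \<and> u \<in> S \<and> c \<in> carrier R \<and> u \<otimes>\<^bsub>R\<^esub> a = c \<otimes>\<^bsub>R\<^esub> t}"

definition frac_add ::
  "('a, 'm) ring_scheme \<Rightarrow> 'a set \<Rightarrow> ('a \<times> 'a) set \<Rightarrow> ('a \<times> 'a) set \<Rightarrow> ('a \<times> 'a) set"
  where "frac_add R S A B =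
    \<Union> {left_frac R S (c \<otimes>\<^bsub>R\<^esub> s) ((c \<otimes>\<^bsub>R\<^esub> a) \<oplus>\<^bsub>R\<^esub> (d \<otimes>\<^bsub>R\<^esub> b)) | s a t b c d.
      (s, a) \<in> A \<and> (t, b) \<in> B \<and> c \<in> carrier R \<and> d \<in> carrier R \<and>
      c \<otimes>\<^bsub>R\<^esub> s \<in> S \<and> c \<otimes>\<^bsub>R\<^esub> s = d \<otimes>\<^bsub>R\<^esub> t}"

definition left_localization :: "('a, 'm) ring_scheme \<Rightarrow> 'a set \<Rightarrow> ('a \<times> 'a) set ring"
  where "left_localization R S =
    \<lparr> carrier = (S \<times> carrier R) // frac_rel R S,
      monoid.mult = frac_mult R S,
      one = left_frac R S \<one>\<^bsub>R\<^esub> \<one>\<^bsub>R\<^esub>,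
      zero = left_frac R S \<one>\<^bsub>R\<^esub> \<zero>\<^bsub>R\<^esub>,
      add = frac_add R S \<rparr>"

definition Q_l :: "('a, 'm) ring_scheme \<Rightarrow> ('a \<times> 'a) set ring"
  where "Q_l R = left_localization R (S_l0 R)"

definition Q_l_s :: "('a, 'm) ring_scheme \<Rightarrow> ('a \<times> 'a) set ring"
  where "Q_l_s R = left_localization R (T_l R)"

text \<open>
  Since \<open>S_l0 R \<subseteq> T_l R\<close>, all representatives of a class of \<open>Q_l R\<close> give the same class of
  \<open>Q_l_s R\<close>; hence the union is that class and \<open>theta\<close> maps \<open>s\<^sup>-\<^sup>1r\<close> to \<open>s\<^sup>-\<^sup>1r\<close>.
\<close>

definition theta :: "('a, 'm) ring_scheme \<Rightarrow> ('a \<times> 'a) set \<Rightarrow> ('a \<times> 'a) set"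
  where "theta R A = (\<Union>(s, r)\<in>A. left_frac R (T_l R) s r)"

definition ring_mono :: "('a, 'm) ring_scheme \<Rightarrow> ('b, 'n) ring_scheme \<Rightarrow> ('a \<Rightarrow> 'b) set"
  where "ring_mono A B = {h \<in> ring_hom A B. inj_on h (carrier A)}"

definition ring_epi :: "('a, 'm) ring_scheme \<Rightarrow> ('b, 'n) ring_scheme \<Rightarrow> ('a \<Rightarrow> 'b) set"
  where "ring_epi A B = {h \<in> ring_hom A B. h ` carrier A = carrier B}"

end

(*
  A monoid generated by left denominator sets is again a left denominator set unless it contains
  zero. Applied to suitable families, this yields that the sets T_l and S_l0 are left denominator
  sets with the expected maximality, and that S_l0 lies in every maximal left denominator set.
  The equivalences then reduce to ass (T_l) = 0. The only substantial implication is from the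
  surjectivity of theta: writing t^-1 = s^-1 r with s in S_l0 forces r t - s into ass (T_l), so r t
  is in S_l0 and hence t is not a left zero divisor.
*)
theory Submission
  imports Defs
begin

section \<open>Submonoids generated by denominator sets\<close>

text \<open>Words grow by a generator on the right, so induction exposes the last letter. In a
  product \<open>r w x\<close> this is the letter that the Ore condition or the reversibility of its
  own denominator set can treat first.\<close>

inductive_set submonoid_gen :: "('a, 'm) monoid_scheme \<Rightarrow> 'a set \<Rightarrow> 'a set"
  for G and X where
  one: "\<one>\<^bsub>G\<^esub> \<in> submonoid_gen G X"
| snoc: "w \<in> submonoid_gen G X \<Longrightarrow> x \<in> X \<Longrightarrow> w \<otimes>\<^bsub>G\<^esub> x \<in> submonoid_gen G X"

context monoid
begin

lemma submonoid_gen_closed: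
  assumes "X \<subseteq> carrier G" "w \<in> submonoid_gen G X"
  shows "w \<in> carrier G"
  using assms(2) by induct (use assms(1) in auto)

lemma submonoid_gen_incl:
  assumes "X \<subseteq> carrier G"
  shows "X \<subseteq> submonoid_gen G X"
proof
  fix x assume "x \<in> X"
  then show "x \<in> submonoid_gen G X"
    using submonoid_gen.snoc[OF submonoid_gen.one, of x X G] assms by (simp add: subset_iff)
qed

lemma submonoid_submonoid_gen:
  assumes X: "X \<subseteq> carrier G"
  shows "submonoid (submonoid_gen G X) G"
proof
  show "submonoid_gen G X \<subseteq> carrier G"
    using submonoid_gen_closed[OF X] by blast
next
  fix v w assume v: "v \<in> submonoid_gen G X" and w: "w \<in> submonoid_gen G X"
  from w show "v \<otimes> w \<in> submonoid_gen G X"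
  proof induct
    case one
    then show ?case using v submonoid_gen_closed[OF X] by simp
  next
    case (snoc w x)
    then have "v \<otimes> (w \<otimes> x) = (v \<otimes> w) \<otimes> x"
      using v X submonoid_gen_closed[OF X] by (simp add: m_assoc subset_iff)
    then show ?case using snoc by (simp add: submonoid_gen.snoc)
  qed
qed (rule submonoid_gen.one)

lemma submonoid_gen_least:
  assumes "submonoid S G" "X \<subseteq> S"
  shows "submonoid_gen G X \<subseteq> S"
proof
  fix w assume "w \<in> submonoid_gen G X"
  then show "w \<in> S"
    by induct (use submonoid.one_closed[OF assms(1)] submonoid.m_closed[OF assms(1)] assms(2) in blast)+
qed

end

section \<open>Elementwise rules for left denominator sets\<close>

lemma Den_l_I:
  assumes "submonoid S R" "\<zero>\<^bsub>R\<^esub> \<notin> S"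
    and "\<And>r s. r \<in> carrier R \<Longrightarrow> s \<in> S \<Longrightarrow>
      \<exists>u\<in>S. \<exists>c\<in>carrier R. u \<otimes>\<^bsub>R\<^esub> r = c \<otimes>\<^bsub>R\<^esub> s"
    and "\<And>r s. r \<in> carrier R \<Longrightarrow> s \<in> S \<Longrightarrow> r \<otimes>\<^bsub>R\<^esub> s = \<zero>\<^bsub>R\<^esub> \<Longrightarrow>
      \<exists>u\<in>S. u \<otimes>\<^bsub>R\<^esub> r = \<zero>\<^bsub>R\<^esub>"
  shows "S \<in> Den_l R"
proof -
  have "(S #>\<^bsub>R\<^esub> r) \<inter> (carrier R #>\<^bsub>R\<^esub> s) \<noteq> {}"
    if "r \<in> carrier R" "s \<in> S" for r s
    using assms(3)[OF that] unfolding r_coset_def by blast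
  then show ?thesis
    using assms(1,2,4) unfolding Den_l_def left_Ore_set_def multiplicative_subset_def ass_def
    by blast
qed

lemma Den_l_submonoid: "S \<in> Den_l R \<Longrightarrow> submonoid S R"
  by (simp add: Den_l_def left_Ore_set_def multiplicative_subset_def)

lemma Den_l_subset: "S \<in> Den_l R \<Longrightarrow> S \<subseteq> carrier R"
  by (rule submonoid.subset[OF Den_l_submonoid])

lemma Union_Den_l_subset:
  assumes "F \<subseteq> Den_l R"
  shows "\<Union>F \<subseteq> carrier R"
proof (rule Sup_least)
  fix S assume "S \<in> F"
  then show "S \<subseteq> carrier R" using assms by (intro Den_l_subset) blast
qed

lemma Den_l_one: "S \<in> Den_l R \<Longrightarrow> \<one>\<^bsub>R\<^esub> \<in> S"
  by (rule submonoid.one_closed[OF Den_l_submonoid])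

lemma Den_l_mult: "S \<in> Den_l R \<Longrightarrow> s \<in> S \<Longrightarrow> t \<in> S \<Longrightarrow> s \<otimes>\<^bsub>R\<^esub> t \<in> S"
  by (rule submonoid.m_closed[OF Den_l_submonoid])

lemma Den_l_zero: "S \<in> Den_l R \<Longrightarrow> \<zero>\<^bsub>R\<^esub> \<notin> S"
  by (simp add: Den_l_def left_Ore_set_def multiplicative_subset_def)

lemma Den_l_Ore:
  assumes "S \<in> Den_l R" "r \<in> carrier R" "s \<in> S"
  obtains u c where "u \<in> S" "c \<in> carrier R" "u \<otimes>\<^bsub>R\<^esub> r = c \<otimes>\<^bsub>R\<^esub> s"
proof -
  have "(S #>\<^bsub>R\<^esub> r) \<inter> (carrier R #>\<^bsub>R\<^esub> s) \<noteq> {}"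
    using assms unfolding Den_l_def left_Ore_set_def by blast
  then show thesis using that unfolding r_coset_def by blast
qed

lemma Den_l_reversible:
  assumes "S \<in> Den_l R" "r \<in> carrier R" "s \<in> S" "r \<otimes>\<^bsub>R\<^esub> s = \<zero>\<^bsub>R\<^esub>"
  obtains u where "u \<in> S" "u \<otimes>\<^bsub>R\<^esub> r = \<zero>\<^bsub>R\<^esub>"
  using assms unfolding Den_l_def ass_def by blast

context ring
begin

text \<open>Reversibility applied to the difference of \<open>a\<close> and \<open>b\<close>: a
  right factor from \<open>S\<close> cancels at the price of a left factor from
  \<open>S\<close>.\<close>

lemma Den_l_cancel:
  assumes S: "S \<in> Den_l R" and c: "a \<in> carrier R" "b \<in> carrier R" "s \<in> S" "a \<otimes> s = b \<otimes> s"
  obtains u where "u \<in> S" "u \<otimes> a = u \<otimes> b"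
proof -
  note sub = subsetD[OF Den_l_subset[OF S]]
  have "(a \<ominus> b) \<otimes> s = \<zero>"
    using c sub[OF c(3)] by (simp add: minus_eq l_distr l_minus r_neg)
  then obtain u where u: "u \<in> S" "u \<otimes> (a \<ominus> b) = \<zero>"
    using Den_l_reversible[OF S _ c(3)] c minus_closed by metis
  then have "u \<otimes> a \<ominus> u \<otimes> b = \<zero>"
    using c sub[OF u(1)] by (simp add: minus_eq r_distr r_minus)
  then show thesis
    using that[OF u(1)] minus_equality[of "u \<otimes> a" "\<ominus> (u \<otimes> b)"] c sub[OF u(1)]
    by (simp add: minus_eq)
qed

text \<open>Both conditions pass from the generators to words by peeling off the last letter
  \<open>x\<close> with the denominator set that contains it, then treating the shorter word
  \<open>w\<close> by induction. The multipliers obtained on the way accumulate on the left as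
  \<open>v u\<close>, again a word.\<close>

lemma submonoid_gen_Den_l:
  assumes F: "F \<subseteq> Den_l R" and zero: "\<zero> \<notin> submonoid_gen R (\<Union>F)"
  shows "submonoid_gen R (\<Union>F) \<in> Den_l R"
proof -
  let ?M = "submonoid_gen R (\<Union>F)"
  note X = Union_Den_l_subset[OF F]
  note M = submonoid_gen_closed[OF X] and incl = subsetD[OF submonoid_gen_incl[OF X]]
    and mult = submonoid.m_closed[OF submonoid_submonoid_gen[OF X]]
  show ?thesis
  proof (rule Den_l_I[OF submonoid_submonoid_gen[OF X] zero])
    fix r s assume r: "r \<in> carrier R" and s: "s \<in> ?M"
    from s r show "\<exists>u\<in>?M. \<exists>c\<in>carrier R. u \<otimes> r = c \<otimes> s"
    proof (induct arbitrary: r)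
      case one
      then show ?case
        by (intro bexI[of _ \<one>] bexI[of _ r] submonoid_gen.one) simp_all
    next
      case (snoc w x)
      from \<open>x \<in> \<Union>F\<close> obtain S where S: "S \<in> F" "S \<in> Den_l R" "x \<in> S"
        using F by blast
      obtain u c where u: "u \<in> S" "c \<in> carrier R" "u \<otimes> r = c \<otimes> x"
        using Den_l_Ore[OF S(2) snoc(4) S(3)] .
      \<comment> \<open>The induction hypothesis is used for \<open>c\<close>, the new numerator
        left after \<open>x\<close> has been moved past \<open>r\<close>; hence the induction is
        over arbitrary \<open>r\<close>.\<close>
      obtain v d where v: "v \<in> ?M" "d \<in> carrier R" "v \<otimes> c = d \<otimes> w"
        using snoc(2)[OF u(2)] by blast
      have uM: "u \<in> ?M" using incl u(1) S(1) by blast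
      have x: "x \<in> carrier R" using snoc(3) X by blast
      have "(v \<otimes> u) \<otimes> r = v \<otimes> (c \<otimes> x)"
        using M[OF v(1)] M[OF uM] snoc(4) u(3) by (simp add: m_assoc)
      also have "\<dots> = (d \<otimes> w) \<otimes> x"
        using M[OF v(1)] u(2) x v(3) by (simp add: m_assoc[symmetric])
      also have "\<dots> = d \<otimes> (w \<otimes> x)"
        using v(2) M[OF snoc(1)] x by (simp add: m_assoc)
      finally show ?case using mult[OF v(1) uM] v(2) by blast
    qed
  next
    fix r s assume r: "r \<in> carrier R" and s: "s \<in> ?M" and rs: "r \<otimes> s = \<zero>"
    from s r rs show "\<exists>u\<in>?M. u \<otimes> r = \<zero>"
    proof (induct arbitrary: r)
      case one
      then show ?case
        by (intro bexI[of _ \<one>] submonoid_gen.one) simp_all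
    next
      case (snoc w x)
      from \<open>x \<in> \<Union>F\<close> obtain S where S: "S \<in> F" "S \<in> Den_l R" "x \<in> S"
        using F by blast
      have x: "x \<in> carrier R" using snoc(3) X by blast
      note w = M[OF snoc(1)]
      have "(r \<otimes> w) \<otimes> x = \<zero>"
        using snoc(4,5) w x by (simp add: m_assoc)
      then obtain u where u: "u \<in> S" "u \<otimes> (r \<otimes> w) = \<zero>"
        using Den_l_reversible[OF S(2) _ S(3)] snoc(4) w m_closed by metis
      have uM: "u \<in> ?M" using incl u(1) S(1) by blast
      have "(u \<otimes> r) \<otimes> w = \<zero>"
        using u(2) M[OF uM] snoc(4) w by (simp add: m_assoc)
      then obtain v where v: "v \<in> ?M" "v \<otimes> (u \<otimes> r) = \<zero>"
        using snoc(2) M[OF uM] snoc(4) m_closed by metis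
      then have "(v \<otimes> u) \<otimes> r = \<zero>"
        using M[OF v(1)] M[OF uM] snoc(4) by (simp add: m_assoc)
      then show ?case using mult[OF v(1) uM] by blast
    qed
  qed
qed

section \<open>Denominator sets with zero annihilator\<close>

lemma zero_in_ass:
  assumes "S \<in> Den_l R"
  shows "\<zero> \<in> ass R S"
proof -
  have "\<one> \<in> S" "\<one> \<otimes> \<zero> = \<zero>" using Den_l_one[OF assms] by simp_all
  then show ?thesis unfolding ass_def by blast
qed

lemma ass_zero_left_cancel:
  assumes "ass R S = {\<zero>}" "s \<in> S" "r \<in> carrier R" "s \<otimes> r = \<zero>"
  shows "r = \<zero>"
  using assms unfolding ass_def by blast

text \<open>Reversibility turns \<open>r s = 0\<close> into \<open>u r = 0\<close> with
  \<open>u\<close> in \<open>S\<close>, so vanishing of \<open>ass\<close> makes the elements of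
  \<open>S\<close> cancellable on both sides.\<close>

lemma ass_zero_right_cancel:
  assumes "S \<in> Den_l R" "ass R S = {\<zero>}" "s \<in> S" "r \<in> carrier R" "r \<otimes> s = \<zero>"
  shows "r = \<zero>"
proof -
  obtain u where "u \<in> S" "u \<otimes> r = \<zero>"
    using Den_l_reversible[OF assms(1,4,3,5)] .
  then show ?thesis using ass_zero_left_cancel[OF assms(2) _ assms(4)] by blast
qed

lemma singleton_one_Den_l:
  assumes "\<one> \<noteq> \<zero>"
  shows "{\<one>} \<in> Den_l R" "ass R {\<one>} = {\<zero>}"
proof -
  have "submonoid {\<one>} R" by unfold_locales auto
  then show "{\<one>} \<in> Den_l R" using assms by (intro Den_l_I) auto
  show "ass R {\<one>} = {\<zero>}" by (auto simp: ass_def)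
qed


section \<open>The sets \<open>T_l\<close> and \<open>S_l0\<close>\<close>

text \<open>Zorn's lemma: the union of a nonempty chain of left denominator sets is a submonoid that
  omits zero, hence a left denominator set that bounds the chain.\<close>

lemma max_Den_l_nonempty:
  assumes "\<one> \<noteq> \<zero>"
  shows "max_Den_l R \<noteq> {}"
proof -
  have "\<exists>M\<in>Den_l R. \<forall>X\<in>Den_l R. M \<subseteq> X \<longrightarrow> X = M"
  proof (rule subset_Zorn_nonempty)
    show "Den_l R \<noteq> {}" using singleton_one_Den_l[OF assms] by blast
  next
    fix C assume ne: "C \<noteq> {}" and chain: "subset.chain (Den_l R) C"
    then have C: "C \<subseteq> Den_l R" and lin: "\<And>A B. A \<in> C \<Longrightarrow> B \<in> C \<Longrightarrow> A \<subseteq> B \<or> B \<subseteq> A"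
      by (auto simp: subset_chain_def)
    note sub = Union_Den_l_subset[OF C]
    have "submonoid (\<Union>C) R"
    proof
      fix x y assume "x \<in> \<Union>C" "y \<in> \<Union>C"
      then obtain A where A: "A \<in> C" "x \<in> A" "y \<in> A" using lin by blast
      then have "x \<otimes> y \<in> A" using C by (intro Den_l_mult) auto
      then show "x \<otimes> y \<in> \<Union>C" using A(1) by blast
    next
      from ne obtain A where A: "A \<in> C" by blast
      then have "\<one> \<in> A" using C by (intro Den_l_one) blast
      then show "\<one> \<in> \<Union>C" using A by blast
    qed (rule sub)
    \<comment> \<open>Being a submonoid already, the union coincides with the monoid it generates,
      so the result on generated monoids applies to it.\<close>
    then have gen: "submonoid_gen R (\<Union>C) = \<Union>C"
      by (intro equalityI submonoid_gen_least submonoid_gen_incl[OF sub]) simp_all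
    have "\<zero> \<notin> \<Union>C" using C by (auto dest: Den_l_zero)
    then show "\<Union>C \<in> Den_l R"
      using submonoid_gen_Den_l[OF C] gen by simp
  qed
  then obtain M where "M \<in> Den_l R" "\<forall>X\<in>Den_l R. M \<subseteq> X \<longrightarrow> X = M" ..
  then have "M \<in> max_Den_l R" by (simp add: max_Den_l_def)
  then show ?thesis by blast
qed

text \<open>The existence of a maximal left denominator set enters here: an empty intersection would
  be the whole type, neither contained in the carrier nor free of zero.\<close>

lemma submonoid_L_s_l:
  assumes "\<one> \<noteq> \<zero>"
  shows "submonoid (L_s_l R) R" "\<zero> \<notin> L_s_l R"
proof -
  obtain S where S: "S \<in> max_Den_l R"
    using max_Den_l_nonempty[OF assms] by blast
  then have SD: "S \<in> Den_l R" and LS: "L_s_l R \<subseteq> S"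
    by (auto simp: max_Den_l_def L_s_l_def)
  show "submonoid (L_s_l R) R"
  proof
    show "L_s_l R \<subseteq> carrier R" using LS Den_l_subset[OF SD] by (rule subset_trans)
  qed (auto simp: L_s_l_def max_Den_l_def Den_l_mult Den_l_one)
  show "\<zero> \<notin> L_s_l R"
    using LS Den_l_zero[OF SD] by blast
qed

text \<open>The monoid generated by the union stays inside the submonoid \<open>L_s_l\<close>, which
  omits zero. It is therefore a left denominator set inside \<open>L_s_l\<close>, thus one of the
  sets united, and equals the union.\<close>

lemma T_l_Den_l:
  assumes "\<one> \<noteq> \<zero>"
  shows "T_l R \<in> Den_l R"
proof -
  define F where "F = {S \<in> Den_l R. S \<subseteq> L_s_l R}"
  let ?M = "submonoid_gen R (\<Union>F)"
  have T: "T_l R = \<Union>F" by (simp add: T_l_def F_def)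
  have F: "F \<subseteq> Den_l R" by (auto simp: F_def)
  note X = Union_Den_l_subset[OF F]
  have M_sub_L: "?M \<subseteq> L_s_l R"
    by (rule submonoid_gen_least[OF submonoid_L_s_l(1)[OF assms]]) (auto simp: F_def)
  have "?M \<in> Den_l R"
    using M_sub_L submonoid_L_s_l(2)[OF assms] by (intro submonoid_gen_Den_l[OF F]) blast
  moreover from this have "?M = \<Union>F"
    using M_sub_L by (intro equalityI submonoid_gen_incl[OF X]) (auto simp: F_def)
  ultimately show ?thesis using T by simp
qed

text \<open>The candidate is the monoid generated by all left denominator sets with zero
  \<open>ass\<close>. Its words are products of left cancellable elements, so they are left
  cancellable; this keeps zero out and makes \<open>ass\<close> of the monoid trivial. It justifies
  the use of \<open>GREATEST\<close> in \<open>S_l0\<close>.\<close>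

lemma S_l0_greatest:
  assumes "\<one> \<noteq> \<zero>"
  shows "S_l0 R \<in> Den_l R" "ass R (S_l0 R) = {\<zero>}"
    and "\<And>S. S \<in> Den_l R \<Longrightarrow> ass R S = {\<zero>} \<Longrightarrow> S \<subseteq> S_l0 R"
proof -
  define F where "F = {S \<in> Den_l R. ass R S = {\<zero>}}"
  let ?M = "submonoid_gen R (\<Union>F)"
  have F: "F \<subseteq> Den_l R" by (auto simp: F_def)
  note X = Union_Den_l_subset[OF F]
  have cancel: "r = \<zero>" if "w \<in> ?M" "r \<in> carrier R" "w \<otimes> r = \<zero>" for w r
    using that
  proof (induct arbitrary: r)
    case one
    then show ?case by simp
  next
    case (snoc w x)
    from \<open>x \<in> \<Union>F\<close> obtain S where S: "ass R S = {\<zero>}" "x \<in> S" "x \<in> carrier R"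
      using X F_def by blast
    have "w \<otimes> (x \<otimes> r) = \<zero>"
      using snoc(4,5) submonoid_gen_closed[OF X snoc(1)] S(3) by (simp add: m_assoc)
    then have "x \<otimes> r = \<zero>"
      using snoc(2,4) S(3) by blast
    then show ?case using ass_zero_left_cancel[OF S(1,2) snoc(4)] by blast
  qed
  \<comment> \<open>If zero were a word, cancelling it from the product of zero and one would give
    one equal to zero.\<close>
  have "\<zero> \<notin> ?M" using cancel[of \<zero> \<one>] assms by auto
  then have M: "?M \<in> Den_l R" by (rule submonoid_gen_Den_l[OF F])
  have ass: "ass R ?M = {\<zero>}"
    using zero_in_ass[OF M] cancel unfolding ass_def by blast
  have max: "S \<subseteq> ?M" if "S \<in> Den_l R" "ass R S = {\<zero>}" for S
    using that submonoid_gen_incl[OF X] unfolding F_def by blast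
  have "S_l0 R = ?M"
    unfolding S_l0_def using M ass max by (intro Greatest_equality) auto
  then show "S_l0 R \<in> Den_l R" "ass R (S_l0 R) = {\<zero>}"
    and "\<And>S. S \<in> Den_l R \<Longrightarrow> ass R S = {\<zero>} \<Longrightarrow> S \<subseteq> S_l0 R"
    using M ass max by auto
qed

text \<open>The monoid generated by \<open>A\<close> and \<open>S\<close> is a left denominator set
  as soon as it omits zero, and maximality of \<open>S\<close> then forces it to equal
  \<open>S\<close>.\<close>

lemma regular_Den_l_subset_max_Den_l:
  assumes A: "A \<in> Den_l R" "ass R A = {\<zero>}" and S: "S \<in> max_Den_l R"
  shows "A \<subseteq> S"
proof -
  have SD: "S \<in> Den_l R" using S by (simp add: max_Den_l_def)
  let ?M = "submonoid_gen R (\<Union>{A, S})"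
  have F: "{A, S} \<subseteq> Den_l R" using A(1) SD by simp
  note X = Union_Den_l_subset[OF F]
  \<comment> \<open>The multiplier \<open>u\<close> can be chosen in \<open>S\<close> alone: letters
    from \<open>A\<close> cancel on the right without any multiplier, and only letters from
    \<open>S\<close> contribute one.\<close>
  have reversible: "\<exists>u\<in>S. u \<otimes> r = \<zero>" if "w \<in> ?M" "r \<in> carrier R" "r \<otimes> w = \<zero>" for w r
    using that
  proof (induct arbitrary: r)
    case one
    then show ?case using Den_l_one[OF SD] by (intro bexI[of _ \<one>]) simp_all
  next
    case (snoc w x)
    have x: "x \<in> carrier R" using snoc(3) X by blast
    note w = submonoid_gen_closed[OF X snoc(1)]
    have rwx: "(r \<otimes> w) \<otimes> x = \<zero>" using snoc(4,5) w x by (simp add: m_assoc)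
    show ?case
    proof (cases "x \<in> A")
      case True
      then have "r \<otimes> w = \<zero>"
        using ass_zero_right_cancel[OF A True _ rwx] snoc(4) w by blast
      then show ?thesis by (rule snoc(2)[OF snoc(4)])
    next
      case False
      then have "x \<in> S" using snoc(3) by blast
      then obtain u where u: "u \<in> S" "u \<otimes> (r \<otimes> w) = \<zero>"
        using Den_l_reversible[OF SD _ _ rwx] snoc(4) w by blast
      have uc: "u \<in> carrier R" using u(1) Den_l_subset[OF SD] by blast
      have "(u \<otimes> r) \<otimes> w = \<zero>" using u(2) uc snoc(4) w by (simp add: m_assoc)
      then obtain v where v: "v \<in> S" "v \<otimes> (u \<otimes> r) = \<zero>"
        using snoc(2) uc snoc(4) m_closed by metis
      then have "(v \<otimes> u) \<otimes> r = \<zero>"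
        using uc snoc(4) Den_l_subset[OF SD] by (simp add: m_assoc subset_iff)
      then show ?thesis using Den_l_mult[OF SD v(1) u(1)] by blast
    qed
  qed
  \<comment> \<open>Taking \<open>r\<close> to be one and the word to be zero would put zero itself
    into \<open>S\<close>.\<close>
  have "\<zero> \<notin> ?M"
  proof
    assume "\<zero> \<in> ?M"
    then obtain u where u: "u \<in> S" "u \<otimes> \<one> = \<zero>" using reversible[of \<zero> \<one>] by auto
    then have "u = \<zero>" using Den_l_subset[OF SD] by (simp add: subset_iff)
    then show False using u(1) Den_l_zero[OF SD] by blast
  qed
  then have "?M \<in> Den_l R" by (rule submonoid_gen_Den_l[OF F])
  moreover have "A \<subseteq> ?M" "S \<subseteq> ?M" using submonoid_gen_incl[OF X] by auto
  ultimately show ?thesis using S unfolding max_Den_l_def by blast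
qed

lemma S_l0_subset_T_l:
  assumes "\<one> \<noteq> \<zero>"
  shows "S_l0 R \<subseteq> T_l R"
proof -
  note S = S_l0_greatest(1,2)[OF assms]
  have "S_l0 R \<subseteq> L_s_l R"
    unfolding L_s_l_def by (rule Inf_greatest) (rule regular_Den_l_subset_max_Den_l[OF S])
  then show ?thesis using S(1) unfolding T_l_def by blast
qed


section \<open>Fractions\<close>

text \<open>Transitivity is the substantial point: the two given common denominators,
  \<open>d t\<close> and \<open>c' t\<close>, have to be brought to a further common multiple by the
  Ore condition.\<close>

lemma equiv_frac_rel:
  assumes S: "S \<in> Den_l R"
  shows "equiv (S \<times> carrier R) (frac_rel R S)"
proof (rule equivI)
  note sub = subsetD[OF Den_l_subset[OF S]]
  show "frac_rel R S \<subseteq> (S \<times> carrier R) \<times> (S \<times> carrier R)"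
    unfolding frac_rel_def by auto
  show "refl_on (S \<times> carrier R) (frac_rel R S)"
  proof (rule refl_onI)
    fix p assume "p \<in> S \<times> carrier R"
    moreover have "\<exists>c\<in>carrier R. \<exists>d\<in>carrier R. c \<otimes> s \<in> S \<and> c \<otimes> s = d \<otimes> s \<and> c \<otimes> a = d \<otimes> a"
      if "s \<in> S" for s a
      using that sub by (intro bexI[of _ \<one>]) simp_all
    ultimately show "(p, p) \<in> frac_rel R S"
      unfolding frac_rel_def by auto
  qed
  show "sym (frac_rel R S)"
  proof (rule symI)
    fix p q assume pq: "(p, q) \<in> frac_rel R S"
    obtain s a t b where eqs: "p = (s, a)" "q = (t, b)"
      by (metis surj_pair)
    from pq obtain c d where "s \<in> S" "a \<in> carrier R" "t \<in> S" "b \<in> carrier R"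
        "c \<in> carrier R" "d \<in> carrier R" "c \<otimes> s \<in> S" "c \<otimes> s = d \<otimes> t" "c \<otimes> a = d \<otimes> b"
      unfolding frac_rel_def eqs by blast
    moreover from this have "d \<otimes> t \<in> S" "d \<otimes> t = c \<otimes> s" "d \<otimes> b = c \<otimes> a" by simp_all
    ultimately show "(q, p) \<in> frac_rel R S"
      unfolding frac_rel_def eqs by blast
  qed
  show "trans (frac_rel R S)"
  proof (rule transI)
    fix p q q' assume pq: "(p, q) \<in> frac_rel R S" and qo: "(q, q') \<in> frac_rel R S"
    obtain s a t b u e where eqs: "p = (s, a)" "q = (t, b)" "q' = (u, e)"
      by (metis surj_pair)
    from pq obtain c d where 1: "s \<in> S" "a \<in> carrier R" "t \<in> S" "b \<in> carrier R"
        "c \<in> carrier R" "d \<in> carrier R" "c \<otimes> s \<in> S" "c \<otimes> s = d \<otimes> t" "c \<otimes> a = d \<otimes> b"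
      unfolding frac_rel_def eqs by blast
    from qo obtain c' d' where 2: "u \<in> S" "e \<in> carrier R"
        "c' \<in> carrier R" "d' \<in> carrier R" "c' \<otimes> t \<in> S" "c' \<otimes> t = d' \<otimes> u" "c' \<otimes> b = d' \<otimes> e"
      unfolding frac_rel_def eqs by blast
    have car: "s \<in> carrier R" "t \<in> carrier R" "u \<in> carrier R"
      using sub 1 2 by auto
    obtain f g where fg: "f \<in> S" "g \<in> carrier R" "f \<otimes> (d \<otimes> t) = g \<otimes> (c' \<otimes> t)"
      using Den_l_Ore[OF S _ 2(5)] 1(6) car(2) m_closed by metis
    \<comment> \<open>The multipliers agree only after multiplication by \<open>t\<close>, which
      need not be cancellable; the left factor \<open>h\<close> repairs this.\<close>
    have "(f \<otimes> d) \<otimes> t = (g \<otimes> c') \<otimes> t"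
      using fg 1 2 car sub[OF fg(1)] by (simp add: m_assoc)
    then obtain h where h: "h \<in> S" "h \<otimes> (f \<otimes> d) = h \<otimes> (g \<otimes> c')"
      using Den_l_cancel[OF S, of "f \<otimes> d" "g \<otimes> c'" t] fg 1 2 sub[OF fg(1)] by auto
    note fc = sub[OF fg(1)] and hc = sub[OF h(1)]
    \<comment> \<open>One computation serves twice: for the denominators \<open>s\<close>,
      \<open>t\<close>, \<open>u\<close> and for the numerators \<open>a\<close>, \<open>b\<close>,
      \<open>e\<close>.\<close>
    have key: "(h \<otimes> f \<otimes> c) \<otimes> x = (h \<otimes> g \<otimes> d') \<otimes> z"
      if "x \<in> carrier R" "y \<in> carrier R" "z \<in> carrier R" "c \<otimes> x = d \<otimes> y" "c' \<otimes> y = d' \<otimes> z"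
      for x y z
    proof -
      have "(h \<otimes> f \<otimes> c) \<otimes> x = h \<otimes> f \<otimes> (c \<otimes> x)"
        using fc hc 1 that by (simp add: m_assoc)
      also have "\<dots> = (h \<otimes> (f \<otimes> d)) \<otimes> y"
        using fc hc 1 that by (simp add: m_assoc)
      also have "\<dots> = h \<otimes> g \<otimes> (c' \<otimes> y)"
        using h(2) fg(2) hc 2 that by (simp add: m_assoc)
      also have "\<dots> = (h \<otimes> g \<otimes> d') \<otimes> z"
        using fg(2) hc 2 that by (simp add: m_assoc)
      finally show ?thesis .
    qed
    \<comment> \<open>Grouped this way the denominator is a product of the elements
      \<open>h\<close>, \<open>f\<close> and \<open>c s\<close> of \<open>S\<close>;
      \<open>c\<close> by itself is only known to lie in \<open>R\<close>.\<close>
    have "(h \<otimes> f \<otimes> c) \<otimes> s = (h \<otimes> f) \<otimes> (c \<otimes> s)"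
      using fc hc 1 car by (simp add: m_assoc)
    then have "(h \<otimes> f \<otimes> c) \<otimes> s \<in> S"
      using Den_l_mult[OF S Den_l_mult[OF S h(1) fg(1)] 1(7)] by simp
    moreover have "(h \<otimes> f \<otimes> c) \<otimes> s = (h \<otimes> g \<otimes> d') \<otimes> u"
      by (rule key[OF car 1(8) 2(6)])
    moreover have "(h \<otimes> f \<otimes> c) \<otimes> a = (h \<otimes> g \<otimes> d') \<otimes> e"
      by (rule key[OF 1(2,4) 2(2) 1(9) 2(7)])
    moreover have "h \<otimes> f \<otimes> c \<in> carrier R" "h \<otimes> g \<otimes> d' \<in> carrier R"
      using hc fc fg(2) 1(5) 2(4) by simp_all
    ultimately show "(p, q') \<in> frac_rel R S"
      unfolding frac_rel_def eqs using 1(1,2) 2(1,2) by blast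
  qed
qed

section \<open>The canonical map \<open>theta\<close> on classes of fractions\<close>

lemma frac_rel_mono:
  assumes "S \<subseteq> T"
  shows "frac_rel R S \<subseteq> frac_rel R T"
  unfolding frac_rel_def using subsetD[OF assms] by (intro Collect_mono) auto

text \<open>As a relational image, \<open>theta\<close> is defined on arbitrary sets of pairs and
  commutes with unions.\<close>

lemma theta_eq_Image: "theta R A = frac_rel R (T_l R) `` A"
  unfolding theta_def left_frac_def by auto

text \<open>All representatives of the class over \<open>S_l0\<close> are related over the larger
  set \<open>T_l\<close>, so the union consists of copies of one class; reflexivity supplies at
  least one copy.\<close>

lemma theta_left_frac:
  assumes "\<one> \<noteq> \<zero>" "s \<in> S_l0 R" "a \<in> carrier R"
  shows "theta R (left_frac R (S_l0 R) s a) = left_frac R (T_l R) s a"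
proof -
  note E = equiv_frac_rel[OF T_l_Den_l[OF assms(1)]]
  note E0 = equiv_frac_rel[OF S_l0_greatest(1)[OF assms(1)]]
  have "((s, a), (s, a)) \<in> frac_rel R (S_l0 R)"
    using E0 assms(2,3) by (auto elim: equivE dest: refl_onD)
  moreover have "frac_rel R (T_l R) `` {p} = frac_rel R (T_l R) `` {(s, a)}"
    if "((s, a), p) \<in> frac_rel R (S_l0 R)" for p
    using equiv_class_eq[OF E] that frac_rel_mono[OF S_l0_subset_T_l[OF assms(1)]] by blast
  ultimately show ?thesis
    unfolding theta_eq_Image left_frac_def by blast
qed

lemma frac_rel_Image_idem:
  assumes "S \<in> Den_l R"
  shows "frac_rel R S `` (frac_rel R S `` A) = frac_rel R S `` A"
proof -
  note E = equiv_frac_rel[OF assms]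
  have "(frac_rel R S)\<inverse> = frac_rel R S"
    using E by (simp add: equiv_def sym_conv_converse_eq)
  then have "frac_rel R S O frac_rel R S = frac_rel R S"
    using equiv_comp_eq[OF E] by simp
  then show ?thesis by (simp flip: relcomp_Image)
qed

text \<open>An element \<open>r\<close> of \<open>l_s\<close> becomes zero over \<open>T_l\<close>.
  Injectivity makes it zero already over \<open>S_l0\<close>, so some element of \<open>S_l0\<close>
  annihilates it, which forces \<open>r\<close> to be zero.\<close>

lemma ass_T_l_zero_if_theta_inj:
  assumes "\<one> \<noteq> \<zero>" and inj: "inj_on (theta R) (carrier (Q_l R))"
  shows "l_s R = {\<zero>}"
proof -
  note S = S_l0_greatest(1,2)[OF assms(1)] and T = T_l_Den_l[OF assms(1)]
  have one: "\<one> \<in> S_l0 R" "\<one> \<in> T_l R" using Den_l_one S(1) T by auto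
  have "r = \<zero>" if r: "r \<in> l_s R" for r
  proof -
    from r obtain t where rt: "r \<in> carrier R" "t \<in> T_l R" "t \<otimes> r = \<zero>"
      unfolding l_s_def ass_def by blast
    have tc: "t \<in> carrier R" using rt(2) Den_l_subset[OF T] by blast
    \<comment> \<open>Both multipliers are \<open>t\<close>, since \<open>t r\<close> and
      \<open>t\<close> times zero are both zero.\<close>
    have "((\<one>, r), (\<one>, \<zero>)) \<in> frac_rel R (T_l R)"
      unfolding frac_rel_def using rt tc one by fastforce
    then have "left_frac R (T_l R) \<one> r = left_frac R (T_l R) \<one> \<zero>"
      unfolding left_frac_def by (rule equiv_class_eq[OF equiv_frac_rel[OF T]])
    then have "theta R (left_frac R (S_l0 R) \<one> r) = theta R (left_frac R (S_l0 R) \<one> \<zero>)"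
      using theta_left_frac[OF assms(1) one(1)] rt(1) by simp
    moreover have "left_frac R (S_l0 R) \<one> x \<in> carrier (Q_l R)" if "x \<in> carrier R" for x
      using that one(1) unfolding Q_l_def left_localization_def left_frac_def
      by (auto intro: quotientI)
    ultimately have "left_frac R (S_l0 R) \<one> r = left_frac R (S_l0 R) \<one> \<zero>"
      using inj_onD[OF inj] rt(1) by blast
    then have "((\<one>, r), (\<one>, \<zero>)) \<in> frac_rel R (S_l0 R)"
      unfolding left_frac_def
      using eq_equiv_class[OF _ equiv_frac_rel[OF S(1)]] one(1) by blast
    then obtain c d where "c \<in> carrier R" "d \<in> carrier R" "c \<otimes> \<one> \<in> S_l0 R"
        "c \<otimes> \<one> = d \<otimes> \<one>" "c \<otimes> r = d \<otimes> \<zero>"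
      unfolding frac_rel_def by blast
    then show ?thesis using ass_zero_left_cancel[OF S(2) _ rt(1)] by simp
  qed
  then show ?thesis using zero_in_ass[OF T] unfolding l_s_def by blast
qed

text \<open>Every \<open>t\<close> in \<open>T_l\<close> turns out to have a left multiple
  \<open>r t\<close> in \<open>S_l0\<close>. Whatever \<open>t\<close> annihilates is annihilated by
  \<open>r t\<close> too, hence is zero.\<close>

lemma ass_T_l_zero_if_theta_surj:
  assumes "\<one> \<noteq> \<zero>" and surj: "theta R ` carrier (Q_l R) = carrier (Q_l_s R)"
    and add: "S_l0 R <+> l_s R \<subseteq> S_l0 R"
  shows "l_s R = {\<zero>}"
proof -
  note S = S_l0_greatest(1,2)[OF assms(1)] and T = T_l_Den_l[OF assms(1)]
    and ST = subsetD[OF S_l0_subset_T_l[OF assms(1)]]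
  note Tc = subsetD[OF Den_l_subset[OF T]]
  have multiple: "\<exists>r\<in>carrier R. r \<otimes> t \<in> S_l0 R" if t: "t \<in> T_l R" for t
  proof -
    have "left_frac R (T_l R) t \<one> \<in> carrier (Q_l_s R)"
      using t unfolding Q_l_s_def left_localization_def left_frac_def
      by (auto intro: quotientI)
    then obtain A where A: "A \<in> carrier (Q_l R)" "left_frac R (T_l R) t \<one> = theta R A"
      using surj by blast
    then obtain s r where sr: "s \<in> S_l0 R" "r \<in> carrier R" "A = left_frac R (S_l0 R) s r"
      unfolding Q_l_def left_localization_def left_frac_def by (auto elim: quotientE)
    have "left_frac R (T_l R) t \<one> = left_frac R (T_l R) s r"
      using A(2) sr theta_left_frac[OF assms(1)] by simp
    then have "((t, \<one>), (s, r)) \<in> frac_rel R (T_l R)"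
      unfolding left_frac_def
      using eq_equiv_class[OF _ equiv_frac_rel[OF T]] ST[OF sr(1)] sr(2) by blast
    then obtain c d where cd: "c \<in> carrier R" "d \<in> carrier R" "c \<otimes> t \<in> T_l R"
        "c \<otimes> t = d \<otimes> s" "c \<otimes> \<one> = d \<otimes> r"
      unfolding frac_rel_def by blast
    have tc: "t \<in> carrier R" and sc: "s \<in> carrier R" using t Tc ST[OF sr(1)] by auto
    have ds: "d \<otimes> s \<in> T_l R" using cd by simp
    txt \<open>As \<open>d s\<close> and \<open>s\<close> lie in \<open>T_l\<close>, the image of \<open>d\<close> is a unit, so \<open>d\<close> has a left multiple
      in \<open>T_l\<close>.\<close>
    obtain u e where ue: "u \<in> T_l R" "e \<in> carrier R" "u \<otimes> s = e \<otimes> (d \<otimes> s)"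
      using Den_l_Ore[OF T sc ds] .
    then have "u \<otimes> s = (e \<otimes> d) \<otimes> s" using cd(2) sc by (simp add: m_assoc)
    then obtain v where v: "v \<in> T_l R" "v \<otimes> u = v \<otimes> (e \<otimes> d)"
      using Den_l_cancel[OF T Tc[OF ue(1)] m_closed[OF ue(2) cd(2)] ST[OF sr(1)]] by blast
    \<comment> \<open>\<open>d\<close> annihilates \<open>z\<close> because \<open>d r = c\<close>
      and \<open>c t = d s\<close>. As \<open>v u\<close> is a left multiple of \<open>d\<close>, it
      annihilates \<open>z\<close> as well, and unlike \<open>d\<close> it is known to lie in
      \<open>T_l\<close>.\<close>
    define z where "z = r \<otimes> t \<ominus> s"
    have z: "z \<in> carrier R" unfolding z_def using sr(2) tc sc by simp
    have "d \<otimes> z = (d \<otimes> r) \<otimes> t \<ominus> d \<otimes> s"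
      unfolding z_def using cd(2) sr(2) tc sc
      by (simp add: minus_eq r_distr r_minus m_assoc)
    also have "\<dots> = \<zero>"
      using cd sc by (simp flip: cd(5) add: minus_eq r_neg)
    finally have "d \<otimes> z = \<zero>" .
    then have "(v \<otimes> u) \<otimes> z = \<zero>"
      unfolding v(2) using Tc[OF v(1)] ue(2) cd(2) z by (simp add: m_assoc)
    then have "z \<in> l_s R"
      unfolding l_s_def ass_def using Den_l_mult[OF T v(1) ue(1)] z by blast
    \<comment> \<open>Here the additive hypothesis is used: it moves \<open>s\<close> by
      \<open>z\<close> within \<open>S_l0\<close>, and the result is \<open>r t\<close>.\<close>
    then have "s \<oplus> z \<in> S_l0 R"
      using add sr(1) unfolding set_add_def' by blast
    moreover have "s \<oplus> z = r \<otimes> t"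
      unfolding z_def minus_eq using sr(2) tc sc a_lcomm[of s "r \<otimes> t" "\<ominus> s"] by (simp add: r_neg)
    ultimately show ?thesis using sr(2) by auto
  qed
  have "x = \<zero>" if x: "x \<in> l_s R" for x
  proof -
    from x obtain t where xt: "x \<in> carrier R" "t \<in> T_l R" "t \<otimes> x = \<zero>"
      unfolding l_s_def ass_def by blast
    obtain r where r: "r \<in> carrier R" "r \<otimes> t \<in> S_l0 R" using multiple[OF xt(2)] by blast
    have "(r \<otimes> t) \<otimes> x = \<zero>" using r(1) xt Tc[OF xt(2)] by (simp add: m_assoc)
    then show ?thesis using ass_zero_left_cancel[OF S(2) r(2) xt(1)] by blast
  qed
  then show ?thesis using zero_in_ass[OF T] unfolding l_s_def by blast
qed

text \<open>When the two sets agree, source and target coincide and \<open>theta\<close> fixes every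
  class, so it acts as the identity on the carrier.\<close>

lemma theta_iso_if_eq:
  assumes "\<one> \<noteq> \<zero>" and eq: "S_l0 R = T_l R"
  shows "theta R \<in> ring_iso (Q_l R) (Q_l_s R)"
proof -
  note T = T_l_Den_l[OF assms(1)]
  note idem = frac_rel_Image_idem[OF T]
  have Q: "Q_l R = Q_l_s R" by (simp add: Q_l_def Q_l_s_def eq)
  have id: "theta R A = A" if "A \<in> carrier (Q_l_s R)" for A
  proof -
    from that have "A \<in> (T_l R \<times> carrier R) // frac_rel R (T_l R)"
      by (simp add: Q_l_s_def left_localization_def)
    then obtain p where "A = frac_rel R (T_l R) `` {p}" by (rule quotientE)
    then show ?thesis by (simp add: theta_eq_Image idem)
  qed
  have frac: "theta R (left_frac R (T_l R) s a) = left_frac R (T_l R) s a" for s a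
    using idem unfolding theta_eq_Image left_frac_def by simp
  \<comment> \<open>Products and sums are unions of classes, and a union of fixed sets is fixed.
    Hence \<open>theta\<close> preserves them without an appeal to independence of
    representatives.\<close>
  have Union: "theta R (\<Union>K) = \<Union>K" if "\<And>A. A \<in> K \<Longrightarrow> theta R A = A" for K
  proof -
    have "theta R (\<Union>K) = (\<Union>A\<in>K. theta R A)"
      unfolding theta_eq_Image by auto
    then show ?thesis using that by simp
  qed
  have "theta R (frac_mult R (T_l R) A B) = frac_mult R (T_l R) A B"
    and "theta R (frac_add R (T_l R) A B) = frac_add R (T_l R) A B" for A B
    unfolding frac_mult_def frac_add_def by (rule Union; clarify; rule frac)+
  then have "theta R \<in> ring_hom (Q_l_s R) (Q_l_s R)"
    by (intro ring_hom_memI)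
      (simp_all add: id, simp_all add: id[unfolded Q_l_s_def left_localization_def]
        Q_l_s_def left_localization_def frac)
  moreover have "bij_betw (theta R) (carrier (Q_l_s R)) (carrier (Q_l_s R))"
    using id by (simp add: bij_betw_def inj_on_def)
  ultimately show ?thesis unfolding ring_iso_def Q by blast
qed

end

theorem lemma2p13:
  fixes R :: "('a, 'm) ring_scheme"
  assumes "ring R" and "\<one>\<^bsub>R\<^esub> \<noteq> \<zero>\<^bsub>R\<^esub>"
  shows "(S_l0 R = T_l R \<longleftrightarrow> l_s R = {\<zero>\<^bsub>R\<^esub>}) \<and>
    (l_s R = {\<zero>\<^bsub>R\<^esub>} \<longleftrightarrow> theta R \<in> ring_iso (Q_l R) (Q_l_s R)) \<and>
    (theta R \<in> ring_iso (Q_l R) (Q_l_s R) \<longleftrightarrow> theta R \<in> ring_mono (Q_l R) (Q_l_s R)) \<and>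
    (theta R \<in> ring_mono (Q_l R) (Q_l_s R) \<longleftrightarrow>
      theta R \<in> ring_epi (Q_l R) (Q_l_s R) \<and> S_l0 R <+>\<^bsub>R\<^esub> l_s R \<subseteq> S_l0 R)"
proof -
  interpret ring R by (rule assms(1))
  note S = S_l0_greatest[OF assms(2)] and T = T_l_Den_l[OF assms(2)]
  have 12: "S_l0 R = T_l R \<longleftrightarrow> l_s R = {\<zero>\<^bsub>R\<^esub>}"
  proof
    assume "S_l0 R = T_l R"
    then show "l_s R = {\<zero>\<^bsub>R\<^esub>}" using S(2) unfolding l_s_def by (rule subst)
  next
    assume "l_s R = {\<zero>\<^bsub>R\<^esub>}"
    then have "T_l R \<subseteq> S_l0 R" by (intro S(3) T) (simp add: l_s_def)
    then show "S_l0 R = T_l R" using S_l0_subset_T_l[OF assms(2)] by blast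
  qed
  have 13: "S_l0 R = T_l R \<Longrightarrow> theta R \<in> ring_iso (Q_l R) (Q_l_s R)"
    by (rule theta_iso_if_eq[OF assms(2)])
  have 34: "theta R \<in> ring_iso (Q_l R) (Q_l_s R) \<Longrightarrow>
      theta R \<in> ring_mono (Q_l R) (Q_l_s R) \<and> theta R \<in> ring_epi (Q_l R) (Q_l_s R)"
    by (simp add: ring_iso_def ring_mono_def ring_epi_def bij_betw_def)
  have 42: "theta R \<in> ring_mono (Q_l R) (Q_l_s R) \<Longrightarrow> l_s R = {\<zero>\<^bsub>R\<^esub>}"
    using ass_T_l_zero_if_theta_inj[OF assms(2)] by (simp add: ring_mono_def)
  have 52: "theta R \<in> ring_epi (Q_l R) (Q_l_s R) \<Longrightarrow> S_l0 R <+>\<^bsub>R\<^esub> l_s R \<subseteq> S_l0 R \<Longrightarrow>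
      l_s R = {\<zero>\<^bsub>R\<^esub>}"
    using ass_T_l_zero_if_theta_surj[OF assms(2)] by (simp add: ring_epi_def)
  \<comment> \<open>Adding only zero leaves each element of \<open>S_l0\<close> unchanged.\<close>
  have 25: "l_s R = {\<zero>\<^bsub>R\<^esub>} \<Longrightarrow> S_l0 R <+>\<^bsub>R\<^esub> l_s R \<subseteq> S_l0 R"
    using Den_l_subset[OF S(1)] by (auto simp: set_add_def')
  show ?thesis using 12 13 34 42 52 25 by blast
qed

end
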